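(* Let $\alpha_1>0$, $\alpha_2>0$, let $\Lambda\subset\{(x_0,x_1,x_2)\in\mathbb R^3: x_1>0,\ x_2>0\}$ be a simply connected open domain, and let $h=h(x_0,x_1,x_2)$ be an $(\alpha_1,\alpha_2)$-bihyperbolic harmonic potential in $\Lambda$. Then $h$ is an $(\alpha_1+\alpha_2)$-axial-hyperbolic harmonic potential in $\Lambda$ if and only if $$x_2\frac{\partial h}{\partial x_1}=x_1\frac{\partial h}{\partial x_2}\quad\text{in }\Lambda .$$
   Context: All functions are real-valued, and "solution" means classical ($C^2$) solution. $\Delta=\frac{\partial^2}{\partial x_0^2}+\frac{\partial^2}{\partial x_1^2}+\frac{\partial^2}{\partial x_2^2}$. For $\alpha_1,\alpha_2>0$, an $(\alpha_1,\alpha_2)$-bihyperbolic harmonic potential in a simply connected open domain $\Lambda\subset\mathbb R^3$ contained in $\{x_1>0,x_2>0\}$ is a solution $h$ in $\Lambda$ of $$\Delta h-\frac{\alpha_1}{x_1}\frac{\partial h}{\partial x_1}-\frac{\alpha_2}{x_2}\frac{\partial h}{\partial x_2}=0 .$$ For $\alpha>0$, an $\alpha$-axial-hyperbolic harmonic potential in a simply connected open domain $\Lambda\subset\mathbb R^3$ on which $\rho=\sqrt{x_1^2+x_2^2}>0$ is a solution $h$ in $\Lambda$ of $$(x_1^2+x_2^2)\Delta h-\alpha\left(x_1\frac{\partial h}{\partial x_1}+x_2\frac{\partial h}{\partial x_2}\right)=0 .$$ *)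

theory Defs
  imports "HOL-Analysis.Analysis"
begin

text \<open>
  Points of three-space are elements of \<^typ>\<open>real^3\<close>. The index type \<^typ>\<open>3\<close> consists of the residues
  modulo 3, so \<open>x $ 0\<close>, \<open>x $ 1\<close>, \<open>x $ 2\<close> are the coordinates \<open>x\<^sub>0\<close>, \<open>x\<^sub>1\<close>, \<open>x\<^sub>2\<close>
  (and \<open>x $ 3 = x $ 0\<close>).
\<close>

lemma distinct_0_1_2: "distinct [0, 1, 2 :: 3]"
  by simp

lemma UNIV_3_from_0: "(UNIV :: 3 set) = {0, 1, 2}"
  by (rule sym, rule card_subset_eq) auto

definition partial_deriv :: "'n::finite \<Rightarrow> (real^'n \<Rightarrow> real) \<Rightarrow> real^'n \<Rightarrow> real" where
  "partial_deriv i f x = deriv (\<lambda>t. f (x + t *\<^sub>R axis i 1)) 0"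

text \<open>
  The next two notions are meant for open sets \<open>S\<close>. Since \<^const>\<open>deriv\<close> is total, existence of the
  partial derivatives has to be required separately.
\<close>

definition C1_on :: "(real^'n::finite) set \<Rightarrow> (real^'n \<Rightarrow> real) \<Rightarrow> bool" where
  "C1_on S f \<longleftrightarrow> continuous_on S f \<and>
     (\<forall>i. (\<forall>x\<in>S. (\<lambda>t. f (x + t *\<^sub>R axis i 1)) field_differentiable (at 0)) \<and>
          continuous_on S (partial_deriv i f))"

definition C2_on :: "(real^'n::finite) set \<Rightarrow> (real^'n \<Rightarrow> real) \<Rightarrow> bool" where
  "C2_on S f \<longleftrightarrow> C1_on S f \<and> (\<forall>i. C1_on S (partial_deriv i f))"

definition laplacian :: "(real^3 \<Rightarrow> real) \<Rightarrow> real^3 \<Rightarrow> real" where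
  "laplacian h x = partial_deriv 0 (partial_deriv 0 h) x
     + partial_deriv 1 (partial_deriv 1 h) x + partial_deriv 2 (partial_deriv 2 h) x"

definition simply_connected_domain :: "(real^3) set \<Rightarrow> bool" where
  "simply_connected_domain \<Lambda> \<longleftrightarrow> open \<Lambda> \<and> \<Lambda> \<noteq> {} \<and> simply_connected \<Lambda>"

definition bihyperbolic_harmonic_potential ::
    "real \<Rightarrow> real \<Rightarrow> (real^3) set \<Rightarrow> (real^3 \<Rightarrow> real) \<Rightarrow> bool" where
  "bihyperbolic_harmonic_potential \<alpha>1 \<alpha>2 \<Lambda> h \<longleftrightarrow>
     \<alpha>1 > 0 \<and> \<alpha>2 > 0 \<and> simply_connected_domain \<Lambda> \<and> \<Lambda> \<subseteq> {x. x $ 1 > 0 \<and> x $ 2 > 0} \<and>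
     C2_on \<Lambda> h \<and>
     (\<forall>x\<in>\<Lambda>. laplacian h x - \<alpha>1 / x $ 1 * partial_deriv 1 h x
                             - \<alpha>2 / x $ 2 * partial_deriv 2 h x = 0)"

definition axial_hyperbolic_harmonic_potential ::
    "real \<Rightarrow> (real^3) set \<Rightarrow> (real^3 \<Rightarrow> real) \<Rightarrow> bool" where
  "axial_hyperbolic_harmonic_potential \<alpha> \<Lambda> h \<longleftrightarrow>
     \<alpha> > 0 \<and> simply_connected_domain \<Lambda> \<and> \<Lambda> \<subseteq> {x. sqrt ((x $ 1)\<^sup>2 + (x $ 2)\<^sup>2) > 0} \<and>
     C2_on \<Lambda> h \<and>
     (\<forall>x\<in>\<Lambda>. ((x $ 1)\<^sup>2 + (x $ 2)\<^sup>2) * laplacian h x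
              - \<alpha> * (x $ 1 * partial_deriv 1 h x + x $ 2 * partial_deriv 2 h x) = 0)"

end

theory Submission
  imports Defs
begin

text \<open>
  Eliminating the Laplacian with the bihyperbolic equation turns the axial-hyperbolic operator into
  \<open>(\<alpha>1 x\<^sub>2\<^sup>2 - \<alpha>2 x\<^sub>1\<^sup>2) (x\<^sub>2 \<partial>\<^sub>1h - x\<^sub>1 \<partial>\<^sub>2h) / (x\<^sub>1 x\<^sub>2)\<close>. The first factor vanishes only on a
  half-plane with empty interior, so by continuity of the first derivatives the second factor
  vanishes on all of \<open>\<Lambda>\<close> as soon as the product does.
\<close>

lemma axial_operator_factorization:
  fixes u v :: real
  assumes "u > 0" "v > 0" and "L - \<alpha>1 / u * p - \<alpha>2 / v * q = 0"
  shows "(u\<^sup>2 + v\<^sup>2) * L - (\<alpha>1 + \<alpha>2) * (u * p + v * q) =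
    (\<alpha>1 * v\<^sup>2 - \<alpha>2 * u\<^sup>2) * (v * p - u * q) / (u * v)"
proof -
  have L: "L = \<alpha>1 / u * p + \<alpha>2 / v * q"
    using assms(3) by simp
  show ?thesis
    unfolding L using assms(1,2) by (simp add: field_simps power2_eq_square)
qed

text \<open>Where \<open>x $ 1 > 0\<close>, a line parallel to the \<open>x $ 1\<close> axis meets
  the exceptional set \<open>a * (x $ 2)\<^sup>2 = b * (x $ 1)\<^sup>2\<close> at most once. Hence
  every exceptional point of \<open>\<Lambda>\<close> is a limit of points where \<open>D\<close>
  vanishes, and continuity carries the zero over.\<close>

lemma eq_zero_if_eq_zero_off_half_plane:
  fixes D :: "real^3 \<Rightarrow> real"
  assumes "open \<Lambda>" "\<Lambda> \<subseteq> {x. x $ 1 > 0 \<and> x $ 2 > 0}" "continuous_on \<Lambda> D" "b > 0" "z \<in> \<Lambda>"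
    and zero: "\<And>x. x \<in> \<Lambda> \<Longrightarrow> a * (x $ 2)\<^sup>2 \<noteq> b * (x $ 1)\<^sup>2 \<Longrightarrow> D x = 0"
  shows "D z = 0"
proof (cases "a * (z $ 2)\<^sup>2 = b * (z $ 1)\<^sup>2")
  case True
  define g where "g t = z + t *\<^sub>R axis 1 1" for t :: real
  have lim: "(g \<longlongrightarrow> z) (at 0)"
    unfolding g_def by (auto intro!: tendsto_eq_intros)
  have "isCont D z"
    using assms(1,3,5) continuous_on_eq_continuous_at by blast
  then have "((\<lambda>t. D (g t)) \<longlongrightarrow> D z) (at 0)"
    using lim by (rule isCont_tendsto_compose)
  moreover have "\<forall>\<^sub>F t in at 0. D (g t) = 0"
  proof -
    have "\<forall>\<^sub>F t in at 0. g t \<in> \<Lambda>"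
      using topological_tendstoD[OF lim assms(1,5)] .
    moreover have "\<forall>\<^sub>F t in at (0::real). t \<noteq> 0"
      by (simp add: eventually_at_filter)
    ultimately show ?thesis
    proof eventually_elim
      case (elim t)
      have "g t $ 2 = z $ 2" and g1: "g t $ 1 = z $ 1 + t"
        by (simp_all add: g_def axis_def)
      \<comment> \<open>As \<open>x $ 2\<close> is fixed along \<open>g\<close>, an exceptional
        \<open>g t\<close> would share \<open>(x $ 1)\<^sup>2\<close> with \<open>z\<close>;
        squaring is injective on positive reals.\<close>
      moreover have "g t $ 1 > 0" "z $ 1 > 0"
        using elim(1) assms(2,5) by auto
      then have "(g t $ 1)\<^sup>2 \<noteq> (z $ 1)\<^sup>2"
        using elim(2) g1 by (simp add: power2_eq_iff_nonneg)
      ultimately show ?case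
        using zero[OF elim(1)] True \<open>b > 0\<close> by simp
    qed
  qed
  then have "((\<lambda>t. D (g t)) \<longlongrightarrow> 0) (at 0)"
    by (rule tendsto_eventually)
  ultimately show ?thesis
    using tendsto_unique trivial_limit_at by blast
qed (use zero assms(5) in blast)

theorem proposition2:
  fixes \<alpha>1 \<alpha>2 :: real and \<Lambda> :: "(real^3) set" and h :: "real^3 \<Rightarrow> real"
  assumes "\<alpha>1 > 0" and "\<alpha>2 > 0"
    and "simply_connected_domain \<Lambda>"
    and "\<Lambda> \<subseteq> {x. x $ 1 > 0 \<and> x $ 2 > 0}"
    and "bihyperbolic_harmonic_potential \<alpha>1 \<alpha>2 \<Lambda> h"
  shows "axial_hyperbolic_harmonic_potential (\<alpha>1 + \<alpha>2) \<Lambda> h \<longleftrightarrow>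
    (\<forall>x\<in>\<Lambda>. x $ 2 * partial_deriv 1 h x = x $ 1 * partial_deriv 2 h x)"
proof -
  define D where "D x = x $ 2 * partial_deriv 1 h x - x $ 1 * partial_deriv 2 h x" for x
  have pos: "x $ 1 > 0" "x $ 2 > 0" if "x \<in> \<Lambda>" for x
    using that assms(4) by auto
  have C2: "C2_on \<Lambda> h"
    using assms(5) by (simp add: bihyperbolic_harmonic_potential_def)
  have factor: "((x $ 1)\<^sup>2 + (x $ 2)\<^sup>2) * laplacian h x
      - (\<alpha>1 + \<alpha>2) * (x $ 1 * partial_deriv 1 h x + x $ 2 * partial_deriv 2 h x)
    = (\<alpha>1 * (x $ 2)\<^sup>2 - \<alpha>2 * (x $ 1)\<^sup>2) * D x / (x $ 1 * x $ 2)" if "x \<in> \<Lambda>" for x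
    unfolding D_def using assms(5) that
    by (intro axial_operator_factorization pos)
      (auto simp: bihyperbolic_harmonic_potential_def)
  have "\<Lambda> \<subseteq> {x. sqrt ((x $ 1)\<^sup>2 + (x $ 2)\<^sup>2) > 0}"
    using pos by (force intro: add_pos_pos)
  \<comment> \<open>The conditions on domain and regularity hold already, so only the differential
    equation remains, in factored form.\<close>
  then have "axial_hyperbolic_harmonic_potential (\<alpha>1 + \<alpha>2) \<Lambda> h \<longleftrightarrow>
      (\<forall>x\<in>\<Lambda>. (\<alpha>1 * (x $ 2)\<^sup>2 - \<alpha>2 * (x $ 1)\<^sup>2) * D x / (x $ 1 * x $ 2) = 0)"
    using assms(1-3) C2 factor by (simp add: axial_hyperbolic_harmonic_potential_def)
  also have "\<dots> \<longleftrightarrow> (\<forall>x\<in>\<Lambda>. \<alpha>1 * (x $ 2)\<^sup>2 \<noteq> \<alpha>2 * (x $ 1)\<^sup>2 \<longrightarrow> D x = 0)"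
    using pos by fastforce
  also have "\<dots> \<longleftrightarrow> (\<forall>x\<in>\<Lambda>. D x = 0)"
  proof -
    have "open \<Lambda>"
      using assms(3) by (simp add: simply_connected_domain_def)
    moreover have "continuous_on \<Lambda> D"
      unfolding D_def using C2
      by (intro continuous_intros) (auto simp: C2_on_def C1_on_def)
    ultimately show ?thesis
      \<comment> \<open>Here \<open>b\<close> is \<open>\<alpha>2\<close> and \<open>a\<close> is
        \<open>\<alpha>1\<close>, so the exceptional set is the zero set of the first
        factor.\<close>
      using eq_zero_if_eq_zero_off_half_plane[of \<Lambda> D \<alpha>2 _ \<alpha>1] assms(2,4) by blast
  qed
  finally show ?thesis
    by (simp add: D_def)
qed

end
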